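(* Let $0<\alpha\le 1$ and let $a,b>0$ be constants. Solutions are sought in the form of a convergent power series. (i) Consider the homogeneous problem $$x^\alpha D_0^\alpha(xy')=x^2y,\qquad y'(0)=0.$$ Substituting $y(x)=\sum_{n=0}^\infty a_nx^n$ gives $a_1=0$ and $$a_n=\frac{\Gamma(n-\alpha+1)}{n^2\,\Gamma(n)}\,a_{n-2},\qquad n\ge 2,$$ where one can choose $a_0=1$. The resulting series is absolutely convergent, and the solution obtained is $y_H(x)=C\,I_0^\alpha(x)$ for some constant $C$, where $$I_0^\alpha(x)=\sum_{n=0}^\infty\left(\prod_{i=1}^n\frac{\Gamma(2i-\alpha+1)}{\Gamma(2i)}\right)\frac{1}{n!^2}\left(\frac{x}{2}\right)^{2n},$$ with the empty product equal to $1$. (ii) Consider the boundary value problem $$x^\alpha D_0^\alpha(xy')-x^2y=\frac{b}{a}x^2,\qquad y'(0)=0,\qquad y(\sqrt a)=0.$$ The constant $y_p(x)=-b/a$ is a particular solution of the equation, and in the variables $h=-y$, $r=x/\sqrt a\in[0,1]$ the solution of the boundary value problem is $$h(r)=\frac{b}{a}\left(1-\frac{I_0^\alpha(\sqrt a\,r)}{I_0^\alpha(\sqrt a)}\right).$$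
   Context: For $\mu>0$ the fractional integral is $(D_0^{-\mu}g)(x)=\frac{1}{\Gamma(\mu)}\int_0^x(x-t)^{\mu-1}g(t)\,dt$. The Riemann-Liouville fractional derivative is $D_0^\alpha g=\frac{d}{dx}\left(D_0^{-(1-\alpha)}g\right)$ for $0<\alpha<1$, and $D_0^1=\frac{d}{dx}$. The notation $D_0^\alpha(xy')$ means $D_0^\alpha$ applied to the function $x\mapsto xy'(x)$. The unknown $h$, a function of $r\in[0,1]$, is assumed to be representable by a convergent power series. *)

theory Defs
  imports "HOL-Analysis.Analysis"
begin

definition frac_integral :: "real \<Rightarrow> (real \<Rightarrow> real) \<Rightarrow> real \<Rightarrow> real" where
  "frac_integral \<mu> g x = 1 / Gamma \<mu> * integral {0..x} (\<lambda>t. (x - t) powr (\<mu> - 1) * g t)"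

definition rl_deriv :: "real \<Rightarrow> (real \<Rightarrow> real) \<Rightarrow> real \<Rightarrow> real" where
  "rl_deriv \<alpha> g = (if \<alpha> = 1 then deriv g else deriv (frac_integral (1 - \<alpha>) g))"

text \<open>
  Both \<^const>\<open>integral\<close> and \<^const>\<open>deriv\<close> are total and take unspecified values when the
  integral or the derivative does not exist, so existence is a separate predicate.
  Absolute integrability of the kernel makes the integral a Lebesgue integral.
\<close>

definition rl_differentiable :: "real \<Rightarrow> (real \<Rightarrow> real) \<Rightarrow> real \<Rightarrow> bool" where
  "rl_differentiable \<alpha> g x \<longleftrightarrow>
     (if \<alpha> = 1 then g differentiable (at x)
      else (\<forall>\<^sub>F u in nhds x. (\<lambda>t. (u - t) powr (- \<alpha>) * g t) absolutely_integrable_on {0..u}) \<and>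
           frac_integral (1 - \<alpha>) g differentiable (at x))"

definition power_series_on :: "real set \<Rightarrow> (nat \<Rightarrow> real) \<Rightarrow> (real \<Rightarrow> real) \<Rightarrow> bool" where
  "power_series_on S c f \<longleftrightarrow> (\<forall>x\<in>S. (\<lambda>n. c n * x ^ n) sums f x)"

text \<open>
  The left-hand sides below make sense at \<open>x > 0\<close> only if \<open>y\<close> is differentiable there and the
  fractional derivative of \<open>t \<mapsto> t y'(t)\<close> exists. The value of \<^term>\<open>deriv y 0\<close> is irrelevant,
  since it is multiplied by \<open>0\<close>.
\<close>

definition lhs_defined_on :: "real \<Rightarrow> real set \<Rightarrow> (real \<Rightarrow> real) \<Rightarrow> bool" where
  "lhs_defined_on \<alpha> S y \<longleftrightarrow>
     (\<forall>x\<in>S. y differentiable (at x) \<and> rl_differentiable \<alpha> (\<lambda>t. t * deriv y t) x)"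

definition homogeneous_eq_on :: "real \<Rightarrow> real set \<Rightarrow> (real \<Rightarrow> real) \<Rightarrow> bool" where
  "homogeneous_eq_on \<alpha> S y \<longleftrightarrow> lhs_defined_on \<alpha> S y \<and>
     (\<forall>x\<in>S. x powr \<alpha> * rl_deriv \<alpha> (\<lambda>t. t * deriv y t) x = x\<^sup>2 * y x)"

definition inhomogeneous_eq_on ::
    "real \<Rightarrow> real \<Rightarrow> real \<Rightarrow> real set \<Rightarrow> (real \<Rightarrow> real) \<Rightarrow> bool" where
  "inhomogeneous_eq_on \<alpha> a b S y \<longleftrightarrow> lhs_defined_on \<alpha> S y \<and>
     (\<forall>x\<in>S. x powr \<alpha> * rl_deriv \<alpha> (\<lambda>t. t * deriv y t) x - x\<^sup>2 * y x = b / a * x\<^sup>2)"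

text \<open>
  Solutions live on an interval with left end point \<open>0\<close>, so the condition on \<open>y'(0)\<close> is
  one-sided.
\<close>

definition homogeneous_problem :: "real \<Rightarrow> real \<Rightarrow> (real \<Rightarrow> real) \<Rightarrow> bool" where
  "homogeneous_problem \<alpha> R y \<longleftrightarrow>
     homogeneous_eq_on \<alpha> {0<..<R} y \<and>
     (y has_real_derivative 0) (at 0 within {0..<R})"

definition boundary_value_problem :: "real \<Rightarrow> real \<Rightarrow> real \<Rightarrow> (real \<Rightarrow> real) \<Rightarrow> bool" where
  "boundary_value_problem \<alpha> a b y \<longleftrightarrow>
     inhomogeneous_eq_on \<alpha> a b {0<..<sqrt a} y \<and>
     (y has_real_derivative 0) (at 0 within {0..sqrt a}) \<and>
     y (sqrt a) = 0"

definition coeff_recurrence :: "real \<Rightarrow> (nat \<Rightarrow> real) \<Rightarrow> bool" where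
  "coeff_recurrence \<alpha> c \<longleftrightarrow> c 1 = 0 \<and>
     (\<forall>n\<ge>2. c n = Gamma (real n - \<alpha> + 1) / ((real n)\<^sup>2 * Gamma (real n)) * c (n - 2))"

definition I0_term :: "real \<Rightarrow> real \<Rightarrow> nat \<Rightarrow> real" where
  "I0_term \<alpha> x n =
     (\<Prod>i=1..n. Gamma (2 * real i - \<alpha> + 1) / Gamma (2 * real i)) * (1 / (fact n)\<^sup>2) * (x / 2) ^ (2 * n)"

definition I0 :: "real \<Rightarrow> real \<Rightarrow> real" where
  "I0 \<alpha> x = (\<Sum>n. I0_term \<alpha> x n)"

end

theory Submission
  imports Defs "HOL-Complex_Analysis.Cauchy_Integral_Formula"
begin

text \<open>
  The Beta integral and dominated convergence give the fractional integral of a power series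
  term by term. It is \<open>x\<close> to the power \<open>1 - \<alpha>\<close> times another power series, so it can be
  differentiated, and \<open>x powr \<alpha> * D\<^sup>\<alpha>\<close> multiplies the \<open>n\<close>-th coefficient by
  \<open>Gamma (n + 1) / Gamma (n + 1 - \<alpha>)\<close>. The equation then compares two power series on
  \<open>(0, R)\<close>, and by the identity theorem it is equivalent to the recurrence, whose solutions are
  determined by \<open>c 0\<close>. Since \<open>Gamma (2 i - \<alpha> + 1) \<le> Gamma (2 i + 1)\<close>, the terms of \<open>I0\<close> are
  dominated by those of \<open>exp (x\<^sup>2 / 2)\<close>. Adding \<open>b / a\<close> to \<open>y\<close> reduces the boundary value problem
  to the homogeneous one.
\<close>

section \<open>Kernel integrals of monomials and power series\<close>

lemma has_integral_kernel_monomial: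
  fixes \<alpha> x :: real
  assumes "\<alpha> < 1" "0 < x"
  shows "((\<lambda>t. (x - t) powr (- \<alpha>) * t ^ n) has_integral
           Beta (real n + 1) (1 - \<alpha>) * x powr (real n + 1 - \<alpha>)) {0..x}"
proof -
  have "((\<lambda>t. t powr real n * (1 - t) powr (- \<alpha>)) has_integral Beta (real n + 1) (1 - \<alpha>)) {0..1}"
    using has_integral_Beta_real[of "real n + 1" "1 - \<alpha>"] assms by simp
  then have "((\<lambda>t. (t / x) powr real n * (1 - t / x) powr (- \<alpha>)) has_integral
      x * Beta (real n + 1) (1 - \<alpha>)) ((\<lambda>t. t / (1 / x)) ` {0..1})"
    using has_integral_stretch_real[of _ _ 0 1 "1 / x"] assms by fastforce
  moreover have "(\<lambda>t. t / (1 / x)) ` {0..1} = {0..x}"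
    using image_mult_atLeastAtMost[of x 0 1] assms by (simp add: mult.commute)
  ultimately have "((\<lambda>t. (t / x) powr real n * (1 - t / x) powr (- \<alpha>)) has_integral
      x * Beta (real n + 1) (1 - \<alpha>)) {0..x}" by simp
  \<comment> \<open>The factor undoes the rescaling: \<open>x ^ n\<close> comes from
    \<open>t / x\<close>, and \<open>x powr (- \<alpha>)\<close> from the kernel.\<close>
  then have "((\<lambda>t. x powr (real n - \<alpha>) * ((t / x) powr real n * (1 - t / x) powr (- \<alpha>))) has_integral
      x powr (real n - \<alpha>) * (x * Beta (real n + 1) (1 - \<alpha>))) {0..x}"
    by (rule has_integral_mult_right)
  moreover have "x powr (real n - \<alpha>) * (x * Beta (real n + 1) (1 - \<alpha>)) =
      Beta (real n + 1) (1 - \<alpha>) * x powr (real n + 1 - \<alpha>)"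
    using assms powr_add[of x "real n - \<alpha>" 1] by (simp add: algebra_simps)
  ultimately have *: "((\<lambda>t. x powr (real n - \<alpha>) * ((t / x) powr real n * (1 - t / x) powr (- \<alpha>))) has_integral
      Beta (real n + 1) (1 - \<alpha>) * x powr (real n + 1 - \<alpha>)) {0..x}" by simp
  show ?thesis
  \<comment> \<open>The integrands may differ at \<open>t = 0\<close>: for \<open>n = 0\<close>,
    \<open>0 ^ 0\<close> is 1 but \<open>0 powr 0\<close> is 0.\<close>
  proof (rule has_integral_spike[OF negligible_sing _ *])
    fix t assume t: "t \<in> {0..x} - {0}"
    have "1 - t / x = (x - t) / x"
      using assms by (simp add: field_simps)
    then have "(t / x) powr real n * (1 - t / x) powr (- \<alpha>) =
        t ^ n * (x - t) powr (- \<alpha>) / (x powr real n * x powr (- \<alpha>))"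
      using t assms by (simp add: powr_divide powr_realpow)
    also have "x powr real n * x powr (- \<alpha>) = x powr (real n - \<alpha>)"
      by (simp flip: powr_add)
    finally show "(x - t) powr (- \<alpha>) * t ^ n =
        x powr (real n - \<alpha>) * ((t / x) powr real n * (1 - t / x) powr (- \<alpha>))"
      using assms by simp
  qed
qed

text \<open>On \<open>{0..x}\<close> every partial sum is bounded by the sum of absolute values at
  the right end point, so a constant multiple of the kernel dominates and dominated convergence
  permits termwise integration.\<close>

lemma kernel_integral_power_series:
  fixes \<alpha> x :: real
  assumes "\<alpha> < 1" "0 < x"
    and g: "\<And>t. t \<in> {0..x} \<Longrightarrow> (\<lambda>n. e n * t ^ n) sums g t"
    and abs: "summable (\<lambda>n. \<bar>e n * x ^ n\<bar>)"
  shows "(\<lambda>t. (x - t) powr (- \<alpha>) * g t) absolutely_integrable_on {0..x}"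
    and "(\<lambda>n. e n * (Beta (real n + 1) (1 - \<alpha>) * x powr (real n + 1 - \<alpha>))) sums
           integral {0..x} (\<lambda>t. (x - t) powr (- \<alpha>) * g t)"
proof -
  define M where "M = (\<Sum>n. \<bar>e n * x ^ n\<bar>)"
  define f where "f = (\<lambda>N t. \<Sum>n<N. e n * ((x - t) powr (- \<alpha>) * t ^ n))"
  \<comment> \<open>The factor \<open>t ^ 0\<close> makes the dominating function an instance of the
    monomial integral.\<close>
  define h where "h = (\<lambda>t. M * ((x - t) powr (- \<alpha>) * t ^ 0))"
  have f: "(f N has_integral (\<Sum>n<N. e n * (Beta (real n + 1) (1 - \<alpha>) * x powr (real n + 1 - \<alpha>)))) {0..x}" for N
    unfolding f_def using assms(1,2)
    by (intro has_integral_sum has_integral_mult_right has_integral_kernel_monomial) auto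
  have h: "h integrable_on {0..x}"
    unfolding h_def using has_integral_mult_right[OF has_integral_kernel_monomial[OF assms(1,2), of 0]]
    by blast
  have f_eq: "f N t = (x - t) powr (- \<alpha>) * (\<Sum>n<N. e n * t ^ n)" for N t
    by (simp add: f_def sum_distrib_left algebra_simps)
  have le: "norm (f N t) \<le> h t" if t: "t \<in> {0..x}" for N t
  proof -
    have "\<bar>\<Sum>n<N. e n * t ^ n\<bar> \<le> (\<Sum>n<N. \<bar>e n * x ^ n\<bar>)"
      using t by (intro order.trans[OF sum_abs] sum_mono)
        (auto simp: abs_mult intro!: mult_left_mono power_mono)
    also have "\<dots> \<le> M"
      unfolding M_def by (intro sum_le_suminf abs) auto
    finally show ?thesis
      unfolding f_eq h_def by (simp add: abs_mult mult.commute[of M] mult_left_mono)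
  qed
  have conv: "(\<lambda>N. f N t) \<longlonglongrightarrow> (x - t) powr (- \<alpha>) * g t" if "t \<in> {0..x}" for t
    unfolding f_eq using g[OF that] by (intro tendsto_mult tendsto_const) (simp add: sums_def)
  have int: "(\<lambda>t. (x - t) powr (- \<alpha>) * g t) integrable_on {0..x}"
    and lim: "(\<lambda>N. integral {0..x} (f N)) \<longlonglongrightarrow> integral {0..x} (\<lambda>t. (x - t) powr (- \<alpha>) * g t)"
    using dominated_convergence[OF has_integral_integrable[OF f] h le conv] by auto
  show "(\<lambda>n. e n * (Beta (real n + 1) (1 - \<alpha>) * x powr (real n + 1 - \<alpha>))) sums
           integral {0..x} (\<lambda>t. (x - t) powr (- \<alpha>) * g t)"
    using lim unfolding sums_def integral_unique[OF f] .
  \<comment> \<open>The bound on the partial sums passes to the limit and upgrades integrability to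
    absolute integrability.\<close>
  have "norm ((x - t) powr (- \<alpha>) * g t) \<le> h t" if "t \<in> {0..x}" for t
    using le[OF that] conv[OF that] by (intro LIMSEQ_le_const2[OF tendsto_norm]) auto
  then show "(\<lambda>t. (x - t) powr (- \<alpha>) * g t) absolutely_integrable_on {0..x}"
    by (rule absolutely_integrable_integrable_bound[OF _ int h])
qed

section \<open>Convergence and termwise differentiation of power series\<close>

text \<open>Convergence at one \<open>r\<close> strictly between |x| and \<open>R\<close> gives
  absolute convergence at \<open>x\<close>. Thus a series known only on \<open>{0..<R}\<close> also
  converges at negative points, as two-sided differentiation at 0 requires.\<close>

lemma power_series_on_summable:
  assumes "power_series_on {0..<R} e g" "\<bar>x\<bar> < R"
  shows "summable (\<lambda>n. \<bar>e n * x ^ n\<bar>)" "summable (\<lambda>n. e n * x ^ n)"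
proof -
  obtain r where r: "\<bar>x\<bar> < r" "r < R"
    using dense assms(2) by blast
  then have "summable (\<lambda>n. e n * r ^ n)"
    using assms(1) by (auto simp: power_series_on_def sums_iff)
  then show "summable (\<lambda>n. \<bar>e n * x ^ n\<bar>)"
    using powser_insidea[of e r x] r by simp
  then show "summable (\<lambda>n. e n * x ^ n)"
    by (rule summable_rabs_cancel)
qed

text \<open>\<open>g\<close> is tied to the series only on \<open>{0..<R}\<close>, but near an
  interior point it agrees with the sum, which can be differentiated termwise. The factor
  \<open>x\<close> keeps the powers aligned: x d/dx multiplies the n-th coefficient by n.\<close>

lemma power_series_on_deriv:
  assumes ps: "power_series_on {0..<R} e g" and x: "0 < x" "x < R"
  obtains g' where "(g has_real_derivative g') (at x)"
    and "(\<lambda>n. real n * e n * x ^ n) sums (x * g')"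
proof
  define S where "S = (\<lambda>z. \<Sum>n. e n * z ^ n)"
  define g' where "g' = (\<Sum>n. diffs e n * x ^ n)"
  have S: "(S has_real_derivative g') (at x)"
    unfolding S_def g'_def
    by (rule termdiffs_strong'[of R]) (use power_series_on_summable[OF ps] x in auto)
  moreover have "\<forall>\<^sub>F z in nhds x. z \<in> {0<..<R}"
    using x by (intro eventually_nhds_in_open) auto
  then have "\<forall>\<^sub>F z in nhds x. g z = S z"
    by eventually_elim (use ps in \<open>auto simp: power_series_on_def S_def sums_iff\<close>)
  ultimately show "(g has_real_derivative g') (at x)"
    using DERIV_cong_ev[OF refl _ refl] by fast
  have "(\<lambda>n. diffs e n * x ^ n) sums g'"
    unfolding g'_def using power_series_on_summable(2)[OF ps] x
    by (intro summable_sums termdiff_converges[of x R]) auto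
  then have "(\<lambda>n. x * (diffs e n * x ^ n)) sums (x * g')"
    by (rule sums_mult)
  then have "(\<lambda>n. real (Suc n) * e (Suc n) * x ^ Suc n) sums (x * g')"
    by (simp add: diffs_def algebra_simps)
  \<comment> \<open>The added term of index 0 vanishes, so undoing the shift leaves the sum
    unchanged.\<close>
  then show "(\<lambda>n. real n * e n * x ^ n) sums (x * g')"
    using sums_Suc_iff[of "\<lambda>n. real n * e n * x ^ n"] by simp
qed

section \<open>Riemann-Liouville derivatives of power series\<close>

text \<open>The fractional integral is \<open>u powr (1 - \<alpha>) * F u\<close> with a power
  series \<open>F\<close>. By the product rule, differentiation multiplies the n-th coefficient by n
  + 1 - \<alpha>, up to a common power of \<open>x\<close>; this turns Gamma(n + 2 - \<alpha>) in
  the denominator into Gamma(n + 1 - \<alpha>).\<close>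

lemma rl_deriv_power_series_less_1:
  fixes \<alpha> :: real
  assumes \<alpha>: "\<alpha> < 1" and ps: "power_series_on {0..<R} e g" and x: "0 < x" "x < R"
  shows "rl_differentiable \<alpha> g x"
    and "(\<lambda>n. Gamma (real n + 1) / Gamma (real n + 1 - \<alpha>) * e n * x ^ n) sums
           (x powr \<alpha> * rl_deriv \<alpha> g x)"
proof -
  \<comment> \<open>Beta(n + 1, 1 - \<alpha>) / Gamma(1 - \<alpha>) equals Gamma(n + 1) / Gamma(n +
    2 - \<alpha>).\<close>
  define E where "E = (\<lambda>n. Gamma (real n + 1) / Gamma (real n + 2 - \<alpha>) * e n)"
  define F where "F = (\<lambda>u. frac_integral (1 - \<alpha>) g u / u powr (1 - \<alpha>))"
  have kernel: "(\<lambda>t. (u - t) powr (- \<alpha>) * g t) absolutely_integrable_on {0..u}"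
    and F: "(\<lambda>n. E n * u ^ n) sums F u" if u: "0 < u" "u < R" for u
  proof -
    have g: "(\<lambda>n. e n * t ^ n) sums g t" if "t \<in> {0..u}" for t
      using ps u that by (auto simp: power_series_on_def)
    have abs: "summable (\<lambda>n. \<bar>e n * u ^ n\<bar>)"
      using power_series_on_summable[OF ps] u by simp
    note * = kernel_integral_power_series[OF \<alpha> u(1) g abs]
    show "(\<lambda>t. (u - t) powr (- \<alpha>) * g t) absolutely_integrable_on {0..u}"
      using *(1) by simp
    have "(\<lambda>n. 1 / (Gamma (1 - \<alpha>) * u powr (1 - \<alpha>)) *
        (e n * (Beta (real n + 1) (1 - \<alpha>) * u powr (real n + 1 - \<alpha>)))) sums
        (1 / (Gamma (1 - \<alpha>) * u powr (1 - \<alpha>)) * integral {0..u} (\<lambda>t. (u - t) powr (- \<alpha>) * g t))"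
      by (rule sums_mult) (use *(2) in simp)
    moreover have "u powr (real n + 1 - \<alpha>) = u powr (1 - \<alpha>) * u ^ n" for n
      using u powr_add[of u "1 - \<alpha>" "real n"] by (simp add: powr_realpow algebra_simps)
    moreover have "Gamma (1 - \<alpha>) > 0"
      using \<alpha> by simp
    ultimately show "(\<lambda>n. E n * u ^ n) sums F u"
      using u by (simp add: E_def F_def frac_integral_def Beta_def field_simps)
  qed
  have near: "\<forall>\<^sub>F u in nhds x. u \<in> {0<..<R}"
    using x by (intro eventually_nhds_in_open) auto
  \<comment> \<open>\<open>F 0\<close> is 0, being a quotient by 0, whereas the series has the value
    \<open>E 0\<close> there; hence the patch at 0.\<close>
  have ps_F: "power_series_on {0..<R} E (\<lambda>u. if u = 0 then E 0 else F u)"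
    unfolding power_series_on_def using F powser_sums_zero[of E] by auto
  obtain F' where F': "((\<lambda>u. if u = 0 then E 0 else F u) has_real_derivative F') (at x)"
    "(\<lambda>n. real n * E n * x ^ n) sums (x * F')"
    using power_series_on_deriv[OF ps_F x] .
  have "((\<lambda>u. u powr (1 - \<alpha>)) has_real_derivative (1 - \<alpha>) * x powr (- \<alpha>)) (at x)"
    using has_real_derivative_powr[OF x(1), of "1 - \<alpha>"] by simp
  moreover have "x powr (1 - \<alpha>) = x powr (- \<alpha>) * x"
    using x powr_add[of x "- \<alpha>" 1] by simp
  ultimately have "((\<lambda>u. u powr (1 - \<alpha>) * (if u = 0 then E 0 else F u)) has_real_derivative
      x powr (- \<alpha>) * ((1 - \<alpha>) * F x + x * F')) (at x)"
    using DERIV_mult[OF _ F'(1)] x by (fastforce simp: algebra_simps)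
  moreover have "\<forall>\<^sub>F u in nhds x. u powr (1 - \<alpha>) * (if u = 0 then E 0 else F u) = frac_integral (1 - \<alpha>) g u"
    using near by eventually_elim (simp add: F_def)
  ultimately have D: "(frac_integral (1 - \<alpha>) g has_real_derivative
      x powr (- \<alpha>) * ((1 - \<alpha>) * F x + x * F')) (at x)"
    using DERIV_cong_ev[OF refl _ refl] by fast
  moreover have "\<forall>\<^sub>F u in nhds x. (\<lambda>t. (u - t) powr (- \<alpha>) * g t) absolutely_integrable_on {0..u}"
    using near by eventually_elim (use kernel in auto)
  ultimately show "rl_differentiable \<alpha> g x"
    using \<alpha> by (auto simp: rl_differentiable_def real_differentiable_def)
  have "x powr \<alpha> * rl_deriv \<alpha> g x = (1 - \<alpha>) * F x + x * F'"
    using \<alpha> x DERIV_imp_deriv[OF D] by (simp add: rl_deriv_def powr_minus)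
  moreover have "(\<lambda>n. (1 - \<alpha>) * (E n * x ^ n) + real n * E n * x ^ n) sums ((1 - \<alpha>) * F x + x * F')"
    using F[OF x] F'(2) by (intro sums_add sums_mult)
  moreover have "(1 - \<alpha>) * (E n * x ^ n) + real n * E n * x ^ n =
      Gamma (real n + 1) / Gamma (real n + 1 - \<alpha>) * e n * x ^ n" for n
  proof -
    have "real n + 1 - \<alpha> \<notin> \<int>\<^sub>\<le>\<^sub>0"
      using \<alpha> by (auto elim!: nonpos_Ints_cases)
    then have "Gamma (real n + 2 - \<alpha>) = (real n + 1 - \<alpha>) * Gamma (real n + 1 - \<alpha>)"
      using Gamma_plus1[of "real n + 1 - \<alpha>"] by (simp add: algebra_simps)
    moreover have "Gamma (real n + 1 - \<alpha>) > 0"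
      using \<alpha> by (intro Gamma_real_pos) linarith
    ultimately have "(real n + 1 - \<alpha>) * E n = Gamma (real n + 1) / Gamma (real n + 1 - \<alpha>) * e n"
      using \<alpha> by (simp add: E_def)
    moreover have "(1 - \<alpha>) * (E n * x ^ n) + real n * E n * x ^ n = (real n + 1 - \<alpha>) * E n * x ^ n"
      by (simp add: algebra_simps)
    ultimately show ?thesis by simp
  qed
  ultimately show "(\<lambda>n. Gamma (real n + 1) / Gamma (real n + 1 - \<alpha>) * e n * x ^ n) sums
           (x powr \<alpha> * rl_deriv \<alpha> g x)" by simp
qed

lemma rl_deriv_power_series:
  fixes \<alpha> :: real
  assumes "\<alpha> \<le> 1" and ps: "power_series_on {0..<R} e g" and x: "0 < x" "x < R"
  shows "rl_differentiable \<alpha> g x \<and>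
    (\<lambda>n. Gamma (real n + 1) / Gamma (real n + 1 - \<alpha>) * e n * x ^ n) sums
      (x powr \<alpha> * rl_deriv \<alpha> g x)"
proof (cases "\<alpha> = 1")
  case True
  obtain g' where g': "(g has_real_derivative g') (at x)"
    "(\<lambda>n. real n * e n * x ^ n) sums (x * g')"
    using power_series_on_deriv[OF ps x] .
  \<comment> \<open>The general factor at \<alpha> = 1. For \<open>n = 0\<close> it is 0 as well,
    since \<open>Gamma 0\<close> is 0 by convention and so is a quotient by 0.\<close>
  have "Gamma (real n + 1) / Gamma (real n) = real n" for n
  proof (cases "n = 0")
    case False
    then have "real n \<notin> \<int>\<^sub>\<le>\<^sub>0" and "Gamma (real n) > 0"
      by (auto elim!: nonpos_Ints_cases)
    then show ?thesis
      using Gamma_plus1[of "real n"] by simp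
  qed simp
  with True g' x show ?thesis
    by (auto simp: rl_differentiable_def real_differentiable_def rl_deriv_def DERIV_imp_deriv)
next
  case False
  with assms(1) have "\<alpha> < 1" by simp
  with rl_deriv_power_series_less_1[OF _ ps x] show ?thesis by blast
qed


lemma lhs_power_series:
  fixes \<alpha> :: real
  assumes "\<alpha> \<le> 1" and ps: "power_series_on {0..<R} c y"
  shows "lhs_defined_on \<alpha> {0<..<R} y"
    and "\<And>x. x \<in> {0<..<R} \<Longrightarrow>
      (\<lambda>n. Gamma (real n + 1) / Gamma (real n + 1 - \<alpha>) * (real n * c n) * x ^ n) sums
        (x powr \<alpha> * rl_deriv \<alpha> (\<lambda>t. t * deriv y t) x)"
proof -
  have D: "y differentiable (at x) \<and> (\<lambda>n. real n * c n * x ^ n) sums (x * deriv y x)"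
    if x: "0 < x" "x < R" for x
  proof -
    obtain y' where "(y has_real_derivative y') (at x)" "(\<lambda>n. real n * c n * x ^ n) sums (x * y')"
      using power_series_on_deriv[OF ps x] .
    then show ?thesis
      by (auto simp: real_differentiable_def DERIV_imp_deriv)
  qed
  have "power_series_on {0..<R} (\<lambda>n. real n * c n) (\<lambda>t. t * deriv y t)"
    unfolding power_series_on_def
  proof
    fix x assume "x \<in> {0..<R}"
    then show "(\<lambda>n. real n * c n * x ^ n) sums (x * deriv y x)"
      \<comment> \<open>At 0 both sides vanish whatever \<open>deriv y 0\<close> is, since the
        coefficient of index 0 carries the factor n.\<close>
      using D[of x] powser_sums_zero[of "\<lambda>n. real n * c n"] by (cases "x = 0") auto
  qed
  note * = rl_deriv_power_series[OF assms(1) this]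
  show "lhs_defined_on \<alpha> {0<..<R} y"
    using D * by (auto simp: lhs_defined_on_def)
  show "(\<lambda>n. Gamma (real n + 1) / Gamma (real n + 1 - \<alpha>) * (real n * c n) * x ^ n) sums
        (x powr \<alpha> * rl_deriv \<alpha> (\<lambda>t. t * deriv y t) x)" if "x \<in> {0<..<R}" for x
    using * that by auto
qed

section \<open>The identity theorem and the coefficient recurrence\<close>

text \<open>A nonzero coefficient of positive index would make the zero of the sum at 0 isolated,
  but the sum vanishes on all of \<open>{0..<R}\<close>.\<close>

lemma power_series_eq_0:
  fixes a :: "nat \<Rightarrow> real"
  assumes "0 < R" and a: "power_series_on {0..<R} a (\<lambda>x. 0)"
  shows "a n = 0"
proof (rule ccontr)
  assume n: "a n \<noteq> 0"
  have sums: "(\<lambda>n. a n * x ^ n) sums 0" if "x \<in> {0..<R}" for x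
    using a that by (simp add: power_series_on_def)
  have a0: "a 0 = 0"
    using sums_unique2[OF powser_sums_zero sums[of 0]] \<open>0 < R\<close> by simp
  define f where "f = (\<lambda>x. \<Sum>n. a n * x ^ n)"
  have f: "(\<lambda>n. a n * (x - 0) ^ n) sums f x" if "norm (x - 0) < R" for x
    unfolding f_def using power_series_on_summable(2)[OF a] that by (simp add: summable_sums)
  have "f 0 = 0" "n > 0"
    using a0 n by (auto simp: f_def intro: gr0I)
  with powser_0_nonzero[OF \<open>0 < R\<close> f _ n]
  obtain s where s: "0 < s" "\<And>z. z \<in> cball 0 s - {0} \<Longrightarrow> f z \<noteq> 0"
    by metis
  \<comment> \<open>This point lies both in \<open>{0..<R}\<close> and in the punctured ball where
    \<open>f\<close> has no zero.\<close>
  have "f (min s (R / 2)) = 0"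
    unfolding f_def using s(1) \<open>0 < R\<close> by (intro sums_unique[symmetric] sums) auto
  moreover have "min s (R / 2) \<in> cball 0 s - {0}"
    using s(1) \<open>0 < R\<close> by (auto simp: min_def)
  ultimately show False using s(2) by blast
qed

text \<open>This form compares the n-th coefficients of x^\<alpha> D^\<alpha>(x y') and x^2 y. Index
  0 is trivial because of the factor n, index 1 forces \<open>c 1 = 0\<close> since its Gamma
  factors are nonzero, and from index 2 on the equation can be solved for
  \<open>c n\<close>.\<close>

lemma coeff_recurrence_iff:
  assumes "\<alpha> \<le> 1"
  shows "coeff_recurrence \<alpha> c \<longleftrightarrow>
    (\<forall>n. Gamma (real n + 1) / Gamma (real n + 1 - \<alpha>) * (real n * c n) =
         (if n < 2 then 0 else c (n - 2)))"
    (is "_ \<longleftrightarrow> (\<forall>n. ?P n)")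
proof -
  have 0: "?P 0" by simp
  have 1: "?P 1 \<longleftrightarrow> c 1 = 0"
  proof -
    have "Gamma (2 - \<alpha>) \<noteq> 0" "Gamma (2 :: real) \<noteq> 0"
      using Gamma_real_pos[of "2 - \<alpha>"] Gamma_real_pos[of 2] assms by linarith+
    then show ?thesis by simp
  qed
  have 2: "?P n \<longleftrightarrow> c n = Gamma (real n - \<alpha> + 1) / ((real n)\<^sup>2 * Gamma (real n)) * c (n - 2)"
    if n: "n \<ge> 2" for n
  proof -
    have "real n \<notin> \<int>\<^sub>\<le>\<^sub>0"
      using n by (auto elim!: nonpos_Ints_cases)
    then have "Gamma (real n + 1) = real n * Gamma (real n)"
      by (rule Gamma_plus1)
    moreover have "Gamma (real n) > 0" "Gamma (real n - \<alpha> + 1) > 0"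
      using n assms by (auto intro!: Gamma_real_pos)
    \<comment> \<open>Applied with Gamma(n) for \<open>A\<close>, Gamma(n - \<alpha> + 1) for
      \<open>B\<close> and n for \<open>N\<close>.\<close>
    moreover have "N * A / B * (N * u) = v \<longleftrightarrow> u = B / (N\<^sup>2 * A) * v"
      if "A > 0" "B > 0" "N > 0" for A B N u v :: real
      using that by (auto simp: field_simps power2_eq_square)
    moreover have "real n + 1 - \<alpha> = real n - \<alpha> + 1" by simp
    ultimately show ?thesis
      using n by (simp only:) simp
  qed
  have "?P n" if "?P 1" "\<forall>m\<ge>2. ?P m" for n
  proof -
    consider "n = 0" | "n = 1" | "n \<ge> 2" by linarith
    then show ?thesis
      by cases (use 0 that in blast)+
  qed
  then have "(\<forall>n. ?P n) \<longleftrightarrow> ?P 1 \<and> (\<forall>n\<ge>2. ?P n)" by blast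
  with 1 2 show ?thesis
    unfolding coeff_recurrence_def by auto
qed

lemma homogeneous_eq_on_power_series_iff:
  fixes \<alpha> :: real
  assumes "\<alpha> \<le> 1" "0 < R" and ps: "power_series_on {0..<R} c y"
  shows "homogeneous_eq_on \<alpha> {0<..<R} y \<longleftrightarrow> coeff_recurrence \<alpha> c"
proof -
  \<comment> \<open>\<open>d\<close> collects the coefficients of the residual \<open>L\<close> of
    the equation.\<close>
  define d where "d = (\<lambda>n. Gamma (real n + 1) / Gamma (real n + 1 - \<alpha>) * (real n * c n) -
    (if n < 2 then 0 else c (n - 2)))"
  define L where "L = (\<lambda>x. x powr \<alpha> * rl_deriv \<alpha> (\<lambda>t. t * deriv y t) x - x\<^sup>2 * y x)"
  have d0: "d 0 = 0" by (simp add: d_def)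
  have d: "(\<lambda>n. d n * x ^ n) sums L x" if x: "x \<in> {0<..<R}" for x
  proof -
    have "(\<lambda>n. x\<^sup>2 * (c n * x ^ n)) sums (x\<^sup>2 * y x)"
      using ps x by (intro sums_mult) (auto simp: power_series_on_def)
    then have "(\<lambda>n. (if n + 2 < 2 then 0 else c (n + 2 - 2)) * x ^ (n + 2)) sums (x\<^sup>2 * y x)"
      by (simp add: power_add power2_eq_square algebra_simps)
    then have "(\<lambda>n. (if n < 2 then 0 else c (n - 2)) * x ^ n) sums (x\<^sup>2 * y x)"
      by (subst (asm) sums_iff_shift) (simp add: lessThan_nat_numeral)
    from sums_diff[OF lhs_power_series(2)[OF assms(1) ps x] this] show ?thesis
      by (simp add: L_def d_def left_diff_distrib)
  qed
  have "homogeneous_eq_on \<alpha> {0<..<R} y \<longleftrightarrow> (\<forall>x\<in>{0<..<R}. L x = 0)"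
    using lhs_power_series(1)[OF assms(1) ps] by (auto simp: homogeneous_eq_on_def L_def)
  also have "\<dots> \<longleftrightarrow> (\<forall>n. d n = 0)"
  proof
    assume L: "\<forall>x\<in>{0<..<R}. L x = 0"
    \<comment> \<open>The equation is given only for positive \<open>x\<close>; at 0 the series
      vanishes because \<open>d 0 = 0\<close>.\<close>
    have "power_series_on {0..<R} d (\<lambda>x. 0)"
      unfolding power_series_on_def
    proof
      fix x assume "x \<in> {0..<R}"
      then show "(\<lambda>n. d n * x ^ n) sums 0"
        using d[of x] L powser_sums_zero[of d] d0 by (cases "x = 0") auto
    qed
    then show "\<forall>n. d n = 0"
      using power_series_eq_0[OF \<open>0 < R\<close>] by blast
  next
    assume "\<forall>n. d n = 0"
    then show "\<forall>x\<in>{0<..<R}. L x = 0"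
      using d by (auto simp: sums_iff)
  qed
  also have "\<dots> \<longleftrightarrow> coeff_recurrence \<alpha> c"
    unfolding coeff_recurrence_iff[OF assms(1)] d_def by simp
  finally show ?thesis .
qed

text \<open>The one-sided derivative of \<open>y\<close> at 0 is \<open>c 1\<close>, which the
  recurrence sets to 0. It is obtained by restricting the two-sided derivative of the sum to
  \<open>{0..<R}\<close>, where \<open>y\<close> agrees with it.\<close>

lemma homogeneous_problem_power_series_iff:
  fixes \<alpha> :: real
  assumes "\<alpha> \<le> 1" "0 < R" and ps: "power_series_on {0..<R} c y"
  shows "homogeneous_problem \<alpha> R y \<longleftrightarrow> coeff_recurrence \<alpha> c"
proof -
  have "(y has_real_derivative 0) (at 0 within {0..<R})" if "coeff_recurrence \<alpha> c"
  proof -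
    have "((\<lambda>z. \<Sum>n. c n * z ^ n) has_real_derivative (\<Sum>n. diffs c n * 0 ^ n)) (at 0)"
      by (rule termdiffs_strong'[of R]) (use power_series_on_summable[OF ps] \<open>0 < R\<close> in auto)
    moreover have "(\<Sum>n. diffs c n * 0 ^ n) = 0"
      using that by (simp add: diffs_def coeff_recurrence_def)
    ultimately have "((\<lambda>z. \<Sum>n. c n * z ^ n) has_real_derivative 0) (at 0 within {0..<R})"
      by (metis DERIV_subset subset_UNIV)
    then show ?thesis
      by (rule has_field_derivative_transform_within[OF _ \<open>0 < R\<close>])
        (use ps \<open>0 < R\<close> in \<open>auto simp: power_series_on_def sums_iff\<close>)
  qed
  then show ?thesis
    using homogeneous_eq_on_power_series_iff[OF assms] by (auto simp: homogeneous_problem_def)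
qed

section \<open>Solutions of the recurrence and the series \<open>I0\<close>\<close>

lemma coeff_recurrence_mult:
  "coeff_recurrence \<alpha> c \<Longrightarrow> coeff_recurrence \<alpha> (\<lambda>n. k * c n)"
  by (simp add: coeff_recurrence_def)

text \<open>The recurrence is linear and descends by two, with \<open>c 1 = 0\<close>, so
  \<open>c 0\<close> is its only free parameter.\<close>

lemma coeff_recurrence_unique:
  assumes c: "coeff_recurrence \<alpha> c" and c': "coeff_recurrence \<alpha> c'" "c' 0 = 1"
  shows "c n = c 0 * c' n"
proof (induction n rule: less_induct)
  case (less n)
  consider "n = 0" | "n = 1" | "n \<ge> 2" by linarith
  then show ?case
  proof cases
    case 3
    then show ?thesis
      using c c'(1) less[of "n - 2"] by (simp add: coeff_recurrence_def)
  qed (use c c' in \<open>auto simp: coeff_recurrence_def\<close>)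
qed

text \<open>\<open>I0\<close> re-indexed by all powers of \<open>x\<close>, so that it can be
  compared with a general power series; \<open>2 ^ m\<close> stems from
  \<open>(x / 2) ^ (2 * n)\<close> with \<open>m = 2 * n\<close>.\<close>

definition I0_coeff :: "real \<Rightarrow> nat \<Rightarrow> real" where
  "I0_coeff \<alpha> m = (if even m then
     (\<Prod>i=1..m div 2. Gamma (2 * real i - \<alpha> + 1) / Gamma (2 * real i)) *
       (1 / (fact (m div 2))\<^sup>2) / 2 ^ m else 0)"

lemma I0_coeff_0 [simp]: "I0_coeff \<alpha> 0 = 1"
  by (simp add: I0_coeff_def)

lemma I0_term_eq: "I0_term \<alpha> x n = I0_coeff \<alpha> (2 * n) * x ^ (2 * n)"
  by (simp add: I0_coeff_def I0_term_def power_divide)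

lemma coeff_recurrence_I0_coeff: "coeff_recurrence \<alpha> (I0_coeff \<alpha>)"
  unfolding coeff_recurrence_def
proof (intro conjI allI impI)
  fix n :: nat
  assume "n \<ge> 2"
  show "I0_coeff \<alpha> n =
    Gamma (real n - \<alpha> + 1) / ((real n)\<^sup>2 * Gamma (real n)) * I0_coeff \<alpha> (n - 2)"
  proof (cases "even n")
    case True
    with \<open>n \<ge> 2\<close> obtain k where n: "n = 2 * Suc k"
      by (metis evenE not0_implies_Suc mult_0_right not_numeral_le_zero)
    define q where "q = (\<lambda>i. Gamma (2 * real i - \<alpha> + 1) / Gamma (2 * real i))"
    have coeff: "I0_coeff \<alpha> (2 * m) = prod q {1..m} / ((fact m)\<^sup>2 * 2 ^ (2 * m))" for m
      by (simp add: I0_coeff_def q_def)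
    \<comment> \<open>The last factor of the product supplies the Gamma quotient, and the factorials
      and powers of 2 supply n^2.\<close>
    have "prod q {1..Suc k} = prod q {1..k} * (Gamma (real n - \<alpha> + 1) / Gamma (real n))"
      by (simp add: q_def n)
    moreover have "(fact (Suc k))\<^sup>2 * 2 ^ (2 * Suc k) = (real n)\<^sup>2 * ((fact k)\<^sup>2 * 2 ^ (2 * k))"
      by (simp add: n power2_eq_square algebra_simps)
    moreover have "n - 2 = 2 * k" using n by simp
    ultimately have "I0_coeff \<alpha> (2 * Suc k) =
        Gamma (real n - \<alpha> + 1) / ((real n)\<^sup>2 * Gamma (real n)) * I0_coeff \<alpha> (n - 2)"
      unfolding coeff \<open>n - 2 = 2 * k\<close> by (simp only: times_divide_times_eq times_divide_eq_right divide_divide_eq_left mult_ac)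
    then show ?thesis
      using n by simp
  qed (use \<open>n \<ge> 2\<close> in \<open>simp add: I0_coeff_def\<close>)
qed (simp add: I0_coeff_def)

text \<open>Each factor of the product is at most 2i, so the product is at most 2^n n!, which
  cancels one of the two factorials.\<close>

lemma I0_term_bounds:
  assumes "0 \<le> \<alpha>" "\<alpha> \<le> 1"
  shows "0 \<le> I0_term \<alpha> x n" "I0_term \<alpha> x n \<le> (x\<^sup>2 / 2) ^ n / fact n"
proof -
  have q: "0 \<le> Gamma (2 * real i - \<alpha> + 1) / Gamma (2 * real i)"
      "Gamma (2 * real i - \<alpha> + 1) / Gamma (2 * real i) \<le> 2 * real i" if "i \<ge> 1" for i
  proof -
    have pos: "Gamma (2 * real i) > 0" "Gamma (2 * real i - \<alpha> + 1) > 0"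
      using that assms by (auto intro!: Gamma_real_pos)
    then show "0 \<le> Gamma (2 * real i - \<alpha> + 1) / Gamma (2 * real i)" by simp
    have "2 * real i \<notin> \<int>\<^sub>\<le>\<^sub>0"
      using that by (auto elim!: nonpos_Ints_cases)
    then have "Gamma (2 * real i + 1) = 2 * real i * Gamma (2 * real i)"
      by (rule Gamma_plus1)
    \<comment> \<open>Both arguments are at least 2, where Gamma increases; at \<alpha> = 0 they
      coincide and strict monotonicity does not apply.\<close>
    moreover have "Gamma (2 * real i - \<alpha> + 1) \<le> Gamma (2 * real i + 1)"
      using that assms Gamma_real_strict_mono[of "2 * real i - \<alpha> + 1" "2 * real i + 1"]
      by (cases "\<alpha> = 0") auto
    ultimately show "Gamma (2 * real i - \<alpha> + 1) / Gamma (2 * real i) \<le> 2 * real i"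
      using pos by (simp add: field_simps)
  qed
  let ?P = "\<Prod>i=1..n. Gamma (2 * real i - \<alpha> + 1) / Gamma (2 * real i)"
  have P: "0 \<le> ?P" "?P \<le> (\<Prod>i=1..n. 2 * real i)"
    using q by (auto intro!: prod_nonneg prod_mono)
  then show "0 \<le> I0_term \<alpha> x n"
    by (simp add: I0_term_def power_mult)
  have "(\<Prod>i=1..n. 2 * real i) = 2 ^ n * fact n"
    by (simp add: prod.distrib fact_prod)
  with P(2) have "I0_term \<alpha> x n \<le> 2 ^ n * fact n * (1 / (fact n)\<^sup>2) * (x / 2) ^ (2 * n)"
    unfolding I0_term_def by (intro mult_right_mono) (auto simp: power_mult)
  also have "\<dots> = (x\<^sup>2 / 2) ^ n / fact n"
  proof -
    have "(x / 2) ^ (2 * n) = (x\<^sup>2 / 2) ^ n / 2 ^ n"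
      by (simp add: power_mult flip: power_divide) (simp add: power2_eq_square)
    then show ?thesis
      by (simp add: power2_eq_square)
  qed
  finally show "I0_term \<alpha> x n \<le> (x\<^sup>2 / 2) ^ n / fact n" .
qed

lemma summable_I0_term:
  assumes "0 \<le> \<alpha>" "\<alpha> \<le> 1"
  shows "summable (\<lambda>n. \<bar>I0_term \<alpha> x n\<bar>)"
proof (rule summable_comparison_test'[of _ 0])
  show "summable (\<lambda>n. (x\<^sup>2 / 2) ^ n / fact n)"
    using summable_exp[of "x\<^sup>2 / 2"] by (simp only: divide_inverse_commute[of _ "fact _"])
qed (use I0_term_bounds[OF assms] in auto)

lemma I0_sums:
  assumes "0 \<le> \<alpha>" "\<alpha> \<le> 1"
  shows "(\<lambda>n. I0_coeff \<alpha> n * x ^ n) sums I0 \<alpha> x"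
proof -
  have "(\<lambda>n. I0_term \<alpha> x n) sums I0 \<alpha> x"
    unfolding I0_def by (rule summable_sums[OF summable_rabs_cancel[OF summable_I0_term[OF assms]]])
  then have "(\<lambda>n. I0_coeff \<alpha> (2 * n) * x ^ (2 * n)) sums I0 \<alpha> x"
    by (simp add: I0_term_eq)
  then show ?thesis
    by (subst (asm) sums_mono_reindex[of "\<lambda>n. 2 * n"])
      (auto simp: strict_mono_def I0_coeff_def)
qed

text \<open>The term of index 0 is 1 and the others are nonnegative. This justifies dividing by
  \<open>I0 \<alpha> (sqrt a)\<close>.\<close>

lemma I0_pos:
  assumes "0 \<le> \<alpha>" "\<alpha> \<le> 1"
  shows "I0 \<alpha> x > 0"
proof -
  have "(\<Sum>n<1. I0_term \<alpha> x n) \<le> I0 \<alpha> x"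
    unfolding I0_def using I0_term_bounds[OF assms]
    by (intro sum_le_suminf summable_rabs_cancel[OF summable_I0_term[OF assms]]) auto
  then show ?thesis by (simp add: I0_term_def)
qed

text \<open>Stated at a single point so that it also covers the right end point of the boundary
  value problem.\<close>

lemma power_series_recurrence_eq_I0:
  assumes "0 \<le> \<alpha>" "\<alpha> \<le> 1" "coeff_recurrence \<alpha> c" "(\<lambda>n. c n * x ^ n) sums s"
  shows "s = c 0 * I0 \<alpha> x"
proof (rule sums_unique2[OF assms(4)])
  have "(\<lambda>n. c 0 * (I0_coeff \<alpha> n * x ^ n)) sums (c 0 * I0 \<alpha> x)"
    by (intro sums_mult I0_sums assms)
  then show "(\<lambda>n. c n * x ^ n) sums (c 0 * I0 \<alpha> x)"
    using coeff_recurrence_unique[OF assms(3) coeff_recurrence_I0_coeff I0_coeff_0]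
    by (metis (no_types, lifting) ext mult.assoc)
qed

lemma power_series_on_mult_I0:
  assumes "0 \<le> \<alpha>" "\<alpha> \<le> 1" "\<And>x. x \<in> S \<Longrightarrow> y x = k * I0 \<alpha> x"
  shows "power_series_on S (\<lambda>n. k * I0_coeff \<alpha> n) y"
  unfolding power_series_on_def using sums_mult[OF I0_sums[OF assms(1,2)], of k] assms(3)
  by (simp add: mult.assoc)

lemma homogeneous_solution_iff:
  assumes "0 \<le> \<alpha>" "\<alpha> \<le> 1" "0 < R"
  shows "(\<exists>c. power_series_on {0..<R} c y) \<and> homogeneous_problem \<alpha> R y \<longleftrightarrow>
    (\<exists>C. \<forall>x\<in>{0..<R}. y x = C * I0 \<alpha> x)"
proof
  assume "(\<exists>c. power_series_on {0..<R} c y) \<and> homogeneous_problem \<alpha> R y"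
  then obtain c where "power_series_on {0..<R} c y" "coeff_recurrence \<alpha> c"
    using homogeneous_problem_power_series_iff assms by blast
  then have "\<forall>x\<in>{0..<R}. y x = c 0 * I0 \<alpha> x"
    using power_series_recurrence_eq_I0[OF assms(1,2)] by (auto simp: power_series_on_def)
  then show "\<exists>C. \<forall>x\<in>{0..<R}. y x = C * I0 \<alpha> x" ..
next
  assume "\<exists>C. \<forall>x\<in>{0..<R}. y x = C * I0 \<alpha> x"
  then obtain C where "\<And>x. x \<in> {0..<R} \<Longrightarrow> y x = C * I0 \<alpha> x" by blast
  then have "power_series_on {0..<R} (\<lambda>n. C * I0_coeff \<alpha> n) y"
    by (rule power_series_on_mult_I0[OF assms(1,2)])
  then show "(\<exists>c. power_series_on {0..<R} c y) \<and> homogeneous_problem \<alpha> R y"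
    using homogeneous_problem_power_series_iff[OF assms(2,3)]
      coeff_recurrence_mult[OF coeff_recurrence_I0_coeff] by blast
qed

section \<open>The boundary value problem\<close>

lemma DERIV_add_const_iff:
  fixes k :: real
  shows "((\<lambda>x. f x + k) has_real_derivative D) (at x within S) \<longleftrightarrow>
    (f has_real_derivative D) (at x within S)"
  using DERIV_add[of f D x S "\<lambda>_. k" 0] DERIV_add[of "\<lambda>x. f x + k" D x S "\<lambda>_. - k" 0] by auto

lemma inhomogeneous_eq_on_iff:
  "inhomogeneous_eq_on \<alpha> a b S y \<longleftrightarrow> homogeneous_eq_on \<alpha> S (\<lambda>x. y x + b / a)"
proof -
  \<comment> \<open>The predicates from which \<open>deriv\<close> selects a value coincide, so this
    equality holds even where \<open>y\<close> is not differentiable.\<close>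
  have "deriv (\<lambda>x. y x + b / a) = deriv y"
    by (simp add: deriv_def DERIV_add_const_iff fun_eq_iff)
  then show ?thesis
    by (simp add: inhomogeneous_eq_on_def homogeneous_eq_on_def lhs_defined_on_def
        real_differentiable_def DERIV_add_const_iff algebra_simps)
qed

lemma inhomogeneous_eq_on_const:
  assumes "\<alpha> \<le> 1"
  shows "inhomogeneous_eq_on \<alpha> a b {0<..} (\<lambda>x. - b / a)"
proof -
  have "homogeneous_eq_on \<alpha> {0<..<R} (\<lambda>x. 0)" if "0 < R" for R
  proof -
    have "power_series_on {0..<R} (\<lambda>n. 0) (\<lambda>x. 0)" "coeff_recurrence \<alpha> (\<lambda>n. 0)"
      by (auto simp: power_series_on_def coeff_recurrence_def)
    with homogeneous_eq_on_power_series_iff[OF assms that] show ?thesis by blast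
  qed
  \<comment> \<open>Each positive \<open>x\<close> lies in the interval with
    \<open>R = x + 1\<close>.\<close>
  from this[of "_ + 1"] have "homogeneous_eq_on \<alpha> {0<..} (\<lambda>x. 0)"
    unfolding homogeneous_eq_on_def lhs_defined_on_def
    by (smt (verit) greaterThanLessThan_iff greaterThan_iff)
  then show ?thesis
    by (simp add: inhomogeneous_eq_on_iff)
qed

text \<open>The shifted function \<open>z\<close> solves the homogeneous problem, hence is a
  multiple of \<open>I0\<close>; the boundary condition becomes \<open>z s = b / a\<close> and fixes
  the multiple.\<close>

lemma boundary_value_solution_iff:
  assumes "0 \<le> \<alpha>" "\<alpha> \<le> 1" "a > 0"
    and h: "\<And>r. r \<in> {0..1} \<Longrightarrow> h r = - y (sqrt a * r)"
  shows "(\<exists>c. power_series_on {0..1} c h) \<and> boundary_value_problem \<alpha> a b y \<longleftrightarrow>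
    (\<forall>r\<in>{0..1}. h r = b / a * (1 - I0 \<alpha> (sqrt a * r) / I0 \<alpha> (sqrt a)))"
proof -
  define s where "s = sqrt a"
  define z where "z = (\<lambda>x. y x + b / a)"
  have s: "s > 0" using assms(3) by (simp add: s_def)
  have I0s: "I0 \<alpha> s > 0" using I0_pos[OF assms(1,2)] .
  \<comment> \<open>The two one-sided conditions agree because the sets differ only at
    \<open>s\<close>, away from 0.\<close>
  have "at 0 within {0..<s} = at 0 within {0..s}"
    by (rule at_within_nhd[of _ "{..<s}"]) (use s in auto)
  then have bvp: "boundary_value_problem \<alpha> a b y \<longleftrightarrow> homogeneous_problem \<alpha> s z \<and> z s = b / a"
    by (simp add: boundary_value_problem_def homogeneous_problem_def inhomogeneous_eq_on_iff
        DERIV_add_const_iff s_def z_def)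
  have zh: "z x = b / a - h (x / s)" if "x \<in> {0..s}" for x
    using h[of "x / s"] that s by (simp add: z_def flip: s_def)
  show ?thesis
    unfolding s_def[symmetric]
  proof
    assume L: "(\<exists>c. power_series_on {0..1} c h) \<and> boundary_value_problem \<alpha> a b y"
    then obtain c where c: "power_series_on {0..1} c h" by blast
    \<comment> \<open>Coefficients of \<open>z\<close> in powers of \<open>x\<close>:
      \<open>b / a\<close> enters at index 0, and \<open>s ^ n\<close> comes from r = x / s.\<close>
    define d where "d = (\<lambda>n. (if n = 0 then b / a else 0) - c n / s ^ n)"
    have d: "(\<lambda>n. d n * x ^ n) sums z x" if x: "x \<in> {0..s}" for x
    proof -
      have "(\<lambda>n. c n * (x / s) ^ n) sums h (x / s)"
        using c x s by (auto simp: power_series_on_def)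
      from sums_diff[OF sums_single[of 0 "\<lambda>_. b / a"] this] show ?thesis
        unfolding zh[OF x] d_def
        by (rule sums_cong[THEN iffD1, rotated]) (simp add: power_divide left_diff_distrib)
    qed
    then have "coeff_recurrence \<alpha> d"
      using homogeneous_problem_power_series_iff[OF assms(2) s, of d z] L bvp
      by (auto simp: power_series_on_def)
    \<comment> \<open>The recurrence came from \<open>{0..<s}\<close>, but the series converges to
      \<open>z\<close> at \<open>s\<close> too, so the boundary value can be used.\<close>
    then have z: "z x = d 0 * I0 \<alpha> x" if "x \<in> {0..s}" for x
      using power_series_recurrence_eq_I0[OF assms(1,2)] d that by blast
    have d0: "b / a = d 0 * I0 \<alpha> s"
      using z[of s] L bvp s by auto
    have "d 0 = b / a / I0 \<alpha> s"
      unfolding d0 using I0s by simp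
    then show "\<forall>r\<in>{0..1}. h r = b / a * (1 - I0 \<alpha> (s * r) / I0 \<alpha> s)"
      using z[of "s * r" for r] zh[of "s * r" for r] s by (simp add: algebra_simps)
  next
    assume R: "\<forall>r\<in>{0..1}. h r = b / a * (1 - I0 \<alpha> (s * r) / I0 \<alpha> s)"
    define k where "k = b / a / I0 \<alpha> s"
    have h_eq: "h r = b / a - k * I0 \<alpha> (s * r)" if "r \<in> {0..1}" for r
      using R that by (simp add: k_def algebra_simps)
    have z: "z x = k * I0 \<alpha> x" if "x \<in> {0..s}" for x
      using zh[OF that] h_eq[of "x / s"] that s by simp
    have "power_series_on {0..1} (\<lambda>n. (if n = 0 then b / a else 0) - k * I0_coeff \<alpha> n * s ^ n) h"
      unfolding power_series_on_def
    proof
      fix r :: real assume r: "r \<in> {0..1}"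
      show "(\<lambda>n. ((if n = 0 then b / a else 0) - k * I0_coeff \<alpha> n * s ^ n) * r ^ n) sums h r"
        using sums_diff[OF sums_single[of 0 "\<lambda>_. b / a"]
            sums_mult[OF I0_sums[OF assms(1,2), of "s * r"], of k]]
        unfolding h_eq[OF r]
        by (rule sums_cong[THEN iffD1, rotated]) (simp add: power_mult_distrib left_diff_distrib)
    qed
    moreover have "homogeneous_problem \<alpha> s z"
      using homogeneous_solution_iff[OF assms(1,2) s, of z] z by (meson atLeastAtMost_iff atLeastLessThan_iff less_imp_le)
    moreover have "z s = b / a"
      using z[of s] s I0s by (simp add: k_def)
    ultimately show "(\<exists>c. power_series_on {0..1} c h) \<and> boundary_value_problem \<alpha> a b y"
      unfolding bvp by blast
  qed
qed

theorem mainTheorem1: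
  fixes \<alpha> a b :: real
  assumes "0 < \<alpha>" and "\<alpha> \<le> 1" and "a > 0" and "b > 0"
  shows
    "(\<forall>R>0. \<forall>c y. power_series_on {0..<R} c y \<longrightarrow>
        (homogeneous_problem \<alpha> R y \<longleftrightarrow> coeff_recurrence \<alpha> c)) \<and>
     (\<exists>c. c 0 = 1 \<and> coeff_recurrence \<alpha> c \<and>
        (\<forall>x::real. summable (\<lambda>n. \<bar>c n * x ^ n\<bar>)) \<and>
        power_series_on UNIV c (I0 \<alpha>)) \<and>
     (\<forall>x. summable (\<lambda>n. \<bar>I0_term \<alpha> x n\<bar>)) \<and>
     (\<forall>R>0. \<forall>y. ((\<exists>c. power_series_on {0..<R} c y) \<and> homogeneous_problem \<alpha> R y) \<longleftrightarrow>
        (\<exists>C. \<forall>x\<in>{0..<R}. y x = C * I0 \<alpha> x)) \<and>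
     inhomogeneous_eq_on \<alpha> a b {0<..} (\<lambda>x. - b / a) \<and>
     I0 \<alpha> (sqrt a) \<noteq> 0 \<and>
     (\<forall>y h. (\<forall>r\<in>{0..1}. h r = - y (sqrt a * r)) \<longrightarrow>
        ((\<exists>c. power_series_on {0..1} c h) \<and> boundary_value_problem \<alpha> a b y \<longleftrightarrow>
         (\<forall>r\<in>{0..1}. h r = b / a * (1 - I0 \<alpha> (sqrt a * r) / I0 \<alpha> (sqrt a)))))"
proof (intro conjI)
  have \<alpha>: "0 \<le> \<alpha>" using assms(1) by simp
  show "\<forall>R>0. \<forall>c y. power_series_on {0..<R} c y \<longrightarrow>
      (homogeneous_problem \<alpha> R y \<longleftrightarrow> coeff_recurrence \<alpha> c)"
    using homogeneous_problem_power_series_iff[OF assms(2)] by blast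
  have ps: "power_series_on S (I0_coeff \<alpha>) (I0 \<alpha>)" for S
    using I0_sums[OF \<alpha> assms(2)] by (simp add: power_series_on_def)
  moreover have "summable (\<lambda>n. \<bar>I0_coeff \<alpha> n * x ^ n\<bar>)" for x
    \<comment> \<open>The series represents \<open>I0\<close> on every interval, so \<open>R\<close>
      may be any number exceeding |x|.\<close>
    using power_series_on_summable(1)[OF ps, of x "\<bar>x\<bar> + 1"] by simp
  ultimately show "\<exists>c. c 0 = 1 \<and> coeff_recurrence \<alpha> c \<and>
      (\<forall>x::real. summable (\<lambda>n. \<bar>c n * x ^ n\<bar>)) \<and> power_series_on UNIV c (I0 \<alpha>)"
    using coeff_recurrence_I0_coeff I0_coeff_0 by blast
  show "\<forall>x. summable (\<lambda>n. \<bar>I0_term \<alpha> x n\<bar>)"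
    using summable_I0_term[OF \<alpha> assms(2)] by blast
  show "\<forall>R>0. \<forall>y. ((\<exists>c. power_series_on {0..<R} c y) \<and> homogeneous_problem \<alpha> R y) \<longleftrightarrow>
      (\<exists>C. \<forall>x\<in>{0..<R}. y x = C * I0 \<alpha> x)"
    using homogeneous_solution_iff[OF \<alpha> assms(2)] by blast
  show "inhomogeneous_eq_on \<alpha> a b {0<..} (\<lambda>x. - b / a)"
    by (rule inhomogeneous_eq_on_const[OF assms(2)])
  show "I0 \<alpha> (sqrt a) \<noteq> 0"
    using I0_pos[OF \<alpha> assms(2), of "sqrt a"] by simp
  show "\<forall>y h. (\<forall>r\<in>{0..1}. h r = - y (sqrt a * r)) \<longrightarrow>
      ((\<exists>c. power_series_on {0..1} c h) \<and> boundary_value_problem \<alpha> a b y \<longleftrightarrow>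
       (\<forall>r\<in>{0..1}. h r = b / a * (1 - I0 \<alpha> (sqrt a * r) / I0 \<alpha> (sqrt a))))"
    using boundary_value_solution_iff[OF \<alpha> assms(2,3)] by blast
qed

end
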